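(* Assume there is more than one generator participating in the two-stage market with a day-ahead MPM policy, i.e., $|\mathcal{G}|>1$. Write $C_j:=\frac{1}{b^r(|\mathcal{G}|-1)}+c_j$ for $j\in\mathcal{G}$. Then the Nash equilibrium (of the Stackelberg-Nash game described in the context) exists uniquely and is given by \begin{align*} &g_j^d=\left(1-\frac{\sum_{k\in\mathcal{G}}C_k^{-1}}{(|\mathcal{L}|+1)\sum_{k\in\mathcal{G}}c_k^{-1}}\right)\frac{c_j^{-1}}{\sum_{k\in\mathcal{G}}c_k^{-1}}\,d,\quad\forall j\in\mathcal{G},\\ &g_j^r=\frac{C_j^{-1}}{|\mathcal{L}|+1}\cdot\frac{d}{\sum_{k\in\mathcal{G}}c_k^{-1}},\quad\forall j\in\mathcal{G},\\ &\beta_j^d=\left(b^d-\frac{b^d\sum_{k\in\mathcal{G}}C_k^{-1}}{(|\mathcal{L}|+1)\sum_{k\in\mathcal{G}}c_k^{-1}}-\frac{C_j^{-1}}{|\mathcal{L}|+1}\right)\frac{d}{\sum_{k\in\mathcal{G}}c_k^{-1}},\quad\forall j\in\mathcal{G},\\ &d_l^d=d_l+\left(\frac{1}{|\mathcal{L}|+1}d-d_l\right)\frac{\sum_{k\in\mathcal{G}}C_k^{-1}}{\sum_{k\in\mathcal{G}}c_k^{-1}},\quad\forall l\in\mathcal{L},\\ &d_l^r=\left(d_l-\frac{1}{|\mathcal{L}|+1}d\right)\frac{\sum_{k\in\mathcal{G}}C_k^{-1}}{\sum_{k\in\mathcal{G}}c_k^{-1}},\quad\forall l\in\mathcal{L},\\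 &\lambda^d=\frac{d}{\sum_{k\in\mathcal{G}}c_k^{-1}}-\frac{1}{|\mathcal{L}|+1}\cdot\frac{\sum_{k\in\mathcal{G}}C_k^{-1}}{\sum_{k\in\mathcal{G}}c_k^{-1}}\cdot\frac{d}{\sum_{k\in\mathcal{G}}c_k^{-1}},\\ &\lambda^r=\lambda^d+\frac{1}{|\mathcal{L}|+1}\cdot\frac{d}{\sum_{k\in\mathcal{G}}c_k^{-1}}. \end{align*}
   Context: Market: $\mathcal{G}$ (generators) and $\mathcal{L}$ (loads) are finite nonempty sets. Generator $j$ has cost $\frac{c_j}{2}g_j^2$, $c_j>0$, for total dispatch $g_j=g_j^d+g_j^r$ (day-ahead plus real-time dispatch, real numbers). Load $l$ has fixed inelastic demand $d_l>0$ split as $d_l=d_l^d+d_l^r$ with $d_l^d,d_l^r\in\mathbb{R}$; $d:=\sum_{l} d_l$, $d^d:=\sum_l d_l^d$, $d^r:=\sum_l d_l^r=d-d^d$. The day-ahead and real-time prices are $\lambda^d$ and $\lambda^r$. Intercept function bids: with fixed slopes $b^d>0$ (day-ahead) and $b^r>0$ (real-time), the intercept function of generator $j$ is $g_j^d=b^d\lambda^d-\beta_j^d$ in the day-ahead market and $g_j^r=b^r\lambda^r-\beta_j^r$ in the real-time market, with intercept parameters $\beta_j^d,\beta_j^r\in\mathbb{R}$. Each stage clears by supply-demand balance: $\sum_{j}g_j^d=d^d$ and $\sum_j(b^r\lambda^r-\beta_j^r)=d^r$. Day-ahead MPM (market power mitigation) policy: in the day-ahead market, the operator substitutes generator bids by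 true costs, so $g_j^d=c_j^{-1}\lambda^d$ for all $j$, and by day-ahead power balance $\lambda^d=d^d/\sum_{k\in\mathcal{G}}c_k^{-1}$. Generators remain free to bid $\beta_j^r$ in the real-time market. Profit of generator $j$: $\pi_j=\lambda^rg_j^r+\lambda^dg_j^d-\frac{c_j}{2}(g_j^d+g_j^r)^2$. Payment of load $l$: $\rho_l=\lambda^dd_l^d+\lambda^r(d_l-d_l^d)$. Equilibrium (price-anticipating participants, Stackelberg-Nash game): generators are followers: given the day-ahead outcome, they simultaneously choose $\beta_j^r$, each maximizing $\pi_j$ given the others' bids and anticipating the effect of its own bid on the real-time clearing price $\lambda^r$ (real-time subgame equilibrium). Loads are leaders: they simultaneously choose $d_l^d\in\mathbb{R}$ day-ahead (with $d_l^r=d_l-d_l^d$), each minimizing $\rho_l$ given the other loads' choices and anticipating $\lambda^d$ from the policy rule and $\lambda^r$ from the resulting real-time subgame equilibrium.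
   Formalization: The printed formula for β_j^d subtracts g_j^r instead of g_j^d and contradicts g_j^d = b^d λ^d − β_j^d; its last term C_j^{-1}/(|L|+1) is replaced by c_j^{-1}(1 − ΣC_k^{-1}/((|L|+1)Σc_k^{-1})). *)

theory Defs
  imports Complex_Main "HOL-Library.Cardinality"
begin

text \<open>
  Generators and loads are indexed by types \<open>'g\<close> and \<open>'l\<close> of class \<open>finite\<close> (hence nonempty).
  Prices are the solutions of the balance equations. These are unique for positive costs and a
  positive slope, so \<open>THE\<close> is well defined.
\<close>

text \<open>
  Day-ahead market under the mitigation policy: bids are replaced by the true marginal-cost
  schedules \<open>p \<mapsto> p / c j\<close>; \<open>dd\<close> is the aggregate day-ahead demand.
\<close>

definition da_price :: "('g::finite \<Rightarrow> real) \<Rightarrow> real \<Rightarrow> real" where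
  "da_price c dd = (THE p. (\<Sum>j\<in>UNIV. inverse (c j) * p) = dd)"

definition da_dispatch :: "('g::finite \<Rightarrow> real) \<Rightarrow> real \<Rightarrow> 'g \<Rightarrow> real" where
  "da_dispatch c dd j = inverse (c j) * da_price c dd"

text \<open>
  The day-ahead intercept is not a decision under the policy. It is the intercept for which the
  intercept function of slope \<open>bd\<close> passes through the mitigated outcome, i.e. the solution \<open>\<beta>\<close> of
  \<open>da_dispatch c dd j = bd * da_price c dd - \<beta>\<close>.
\<close>

definition da_intercept :: "real \<Rightarrow> ('g::finite \<Rightarrow> real) \<Rightarrow> real \<Rightarrow> 'g \<Rightarrow> real" where
  "da_intercept bd c dd j = bd * da_price c dd - da_dispatch c dd j"

text \<open>Real-time market with slope \<open>br\<close>, intercept bids \<open>\<beta>\<close> and aggregate real-time demand \<open>dr\<close>.\<close>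

definition rt_price :: "real \<Rightarrow> ('g::finite \<Rightarrow> real) \<Rightarrow> real \<Rightarrow> real" where
  "rt_price br \<beta> dr = (THE p. (\<Sum>j\<in>UNIV. br * p - \<beta> j) = dr)"

definition rt_dispatch :: "real \<Rightarrow> ('g::finite \<Rightarrow> real) \<Rightarrow> real \<Rightarrow> 'g \<Rightarrow> real" where
  "rt_dispatch br \<beta> dr j = br * rt_price br \<beta> dr - \<beta> j"

definition gen_profit ::
  "('g::finite \<Rightarrow> real) \<Rightarrow> real \<Rightarrow> real \<Rightarrow> real \<Rightarrow> ('g \<Rightarrow> real) \<Rightarrow> 'g \<Rightarrow> real" where
  "gen_profit c br dd dr \<beta> j =
     rt_price br \<beta> dr * rt_dispatch br \<beta> dr j + da_price c dd * da_dispatch c dd j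
     - c j / 2 * (da_dispatch c dd j + rt_dispatch br \<beta> dr j)\<^sup>2"

text \<open>Nash equilibrium of the real-time subgame reached after the day-ahead outcome for \<open>dd\<close>.\<close>

definition rt_equilibrium ::
  "('g::finite \<Rightarrow> real) \<Rightarrow> real \<Rightarrow> real \<Rightarrow> real \<Rightarrow> ('g \<Rightarrow> real) \<Rightarrow> bool" where
  "rt_equilibrium c br dd dr \<beta> \<longleftrightarrow>
     (\<forall>j x. gen_profit c br dd dr (\<beta>(j := x)) j \<le> gen_profit c br dd dr \<beta> j)"

text \<open>
  \<open>\<delta> l\<close> is the day-ahead demand of load \<open>l\<close>, and \<open>\<sigma>\<close> is the strategy of the followers: \<open>\<sigma> \<delta>\<close> is
  the profile of real-time bids submitted after the day-ahead demands \<open>\<delta>\<close>.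
\<close>

definition load_payment ::
  "('g::finite \<Rightarrow> real) \<Rightarrow> ('l::finite \<Rightarrow> real) \<Rightarrow> real \<Rightarrow> (('l \<Rightarrow> real) \<Rightarrow> 'g \<Rightarrow> real)
    \<Rightarrow> ('l \<Rightarrow> real) \<Rightarrow> 'l \<Rightarrow> real" where
  "load_payment c d br \<sigma> \<delta> l =
     da_price c (\<Sum>i\<in>UNIV. \<delta> i) * \<delta> l
     + rt_price br (\<sigma> \<delta>) (\<Sum>i\<in>UNIV. d i - \<delta> i) * (d l - \<delta> l)"

text \<open>
  Stackelberg-Nash equilibrium: the followers play a real-time equilibrium after every profile of
  day-ahead demands (also off the equilibrium path, which is what deviating leaders anticipate),
  and no load gains from a unilateral day-ahead deviation.
\<close>

definition stackelberg_nash ::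
  "('g::finite \<Rightarrow> real) \<Rightarrow> ('l::finite \<Rightarrow> real) \<Rightarrow> real
    \<Rightarrow> ('l \<Rightarrow> real) \<Rightarrow> (('l \<Rightarrow> real) \<Rightarrow> 'g \<Rightarrow> real) \<Rightarrow> bool" where
  "stackelberg_nash c d br \<delta> \<sigma> \<longleftrightarrow>
     (\<forall>\<delta>'. rt_equilibrium c br (\<Sum>i\<in>UNIV. \<delta>' i) (\<Sum>i\<in>UNIV. d i - \<delta>' i) (\<sigma> \<delta>')) \<and>
     (\<forall>l x. load_payment c d br \<sigma> \<delta> l \<le> load_payment c d br \<sigma> (\<delta>(l := x)) l)"

end

theory Submission
  imports Defs
begin

text \<open>
  Unilateral deviations change the payoffs by a quadratic polynomial of definite sign in the
  deviation, so equilibria of both stages are the solutions of linear first-order conditions.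
  In the real-time subgame the condition is \<open>C j * g\<^sup>r j = \<lambda>\<^sup>r - \<lambda>\<^sup>d\<close>, because mitigation makes the
  day-ahead marginal cost of every generator equal to \<open>\<lambda>\<^sup>d\<close>; summing over generators gives
  \<open>\<lambda>\<^sup>r - \<lambda>\<^sup>d = d\<^sup>r / SC\<close>. Substituting this, load \<open>l\<close> faces the condition
  \<open>d\<^sup>r + d\<^sup>r l = d l * SC / Sc\<close>, and summing over loads determines \<open>d\<^sup>r\<close>.
\<close>

text \<open>For small \<open>t\<close> a nonzero linear term outweighs any quadratic one. This turns
  the absence of profitable deviations into an equality, for generators and loads alike, without
  derivatives.\<close>

lemma linear_le_quadratic_iff:
  fixes a k :: real
  assumes "k > 0"
  shows "(\<forall>t. a * t \<le> k * t\<^sup>2) \<longleftrightarrow> a = 0"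
proof
  assume "\<forall>t. a * t \<le> k * t\<^sup>2"
  \<comment> \<open>The point \<open>a / (2 * k)\<close> maximizes \<open>a * t - k * t^2\<close>,
    with value \<open>a^2 / (4 * k)\<close>.\<close>
  then have "a * (a / (2 * k)) \<le> k * (a / (2 * k))\<^sup>2" by blast
  then have "a\<^sup>2 \<le> 0"
    using assms by (simp add: field_simps power2_eq_square)
  then show "a = 0" by simp
qed (use assms in simp)

section \<open>Clearing prices of the two stages\<close>

lemma sum_inverse_pos:
  fixes c :: "'g::finite \<Rightarrow> real"
  assumes "\<And>j. c j > 0"
  shows "(\<Sum>k\<in>UNIV. inverse (c k)) > 0"
  using assms by (intro sum_pos) auto

lemma da_price_eq:
  assumes "\<And>j. c j > 0"
  shows "da_price c dd = dd / (\<Sum>k\<in>UNIV. inverse (c k))"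
proof -
  have "(\<Sum>j\<in>UNIV. inverse (c j) * p) = dd \<longleftrightarrow> p = dd / (\<Sum>k\<in>UNIV. inverse (c k))" for p
    unfolding sum_distrib_right[symmetric]
    using sum_inverse_pos[of c, OF assms] by (metis less_irrefl mult.commute nonzero_eq_divide_eq)
  then show ?thesis unfolding da_price_def by simp
qed

lemma rt_price_eq:
  fixes \<beta> :: "'g::finite \<Rightarrow> real"
  assumes "br > 0"
  shows "rt_price br \<beta> dr = (dr + sum \<beta> UNIV) / (br * real CARD('g))"
proof -
  have "(\<Sum>j\<in>UNIV. br * p - \<beta> j) = dr \<longleftrightarrow> p = (dr + sum \<beta> UNIV) / (br * real CARD('g))" for p
    using assms by (simp only: sum_subtractf sum_constant) (auto simp: field_simps)
  then show ?thesis unfolding rt_price_def by simp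
qed

lemma sum_rt_dispatch:
  fixes \<beta> :: "'g::finite \<Rightarrow> real"
  assumes "br > 0"
  shows "(\<Sum>j\<in>UNIV. rt_dispatch br \<beta> dr j) = dr"
proof -
  have "(\<Sum>j\<in>UNIV. rt_dispatch br \<beta> dr j) = real CARD('g) * (br * rt_price br \<beta> dr) - sum \<beta> UNIV"
    unfolding rt_dispatch_def by (simp only: sum_subtractf sum_constant mult.assoc)
  then show ?thesis using assms by (simp add: rt_price_eq)
qed

section \<open>Unilateral deviations and the real-time subgame\<close>

lemma sum_upd:
  fixes f :: "'a::finite \<Rightarrow> real"
  shows "sum (f(j := x)) UNIV = sum f UNIV + (x - f j)"
proof -
  have "sum (f(j := x)) UNIV = x + sum (f(j := x)) (UNIV - {j})"
    by (subst sum.remove[of _ j]) auto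
  also have "sum (f(j := x)) (UNIV - {j}) = sum f (UNIV - {j})"
    by (rule sum.cong) auto
  also have "x + \<dots> = sum f UNIV + (x - f j)"
    by (subst (2) sum.remove[of _ j]) auto
  finally show ?thesis .
qed

text \<open>\<open>t\<close> is the change of the dispatch of \<open>j\<close>, as a function of which the profit is concave.\<close>

lemma gen_profit_deviation:
  fixes c \<beta> :: "'g::finite \<Rightarrow> real"
  assumes c: "\<And>j. c j > 0" and br: "br > 0" and N: "CARD('g) > 1"
  defines "m \<equiv> real CARD('g) - 1"
  shows "gen_profit c br dd dr (\<beta>(j := \<beta> j - real CARD('g) / m * t)) j = gen_profit c br dd dr \<beta> j
    + (rt_price br \<beta> dr - da_price c dd - (1 / (br * m) + c j) * rt_dispatch br \<beta> dr j) * t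
    - (1 / (br * m) + c j / 2) * t\<^sup>2"
proof -
  let ?N = "real CARD('g)" and ?\<beta>' = "\<beta>(j := \<beta> j - real CARD('g) / m * t)"
  have m: "m > 0" and Nm: "?N = m + 1" using N by (auto simp: m_def)
  \<comment> \<open>Lowering the own intercept by \<open>s\<close> lowers the price by
    \<open>s / (br * N)\<close>, so the own dispatch rises only by \<open>s * m / N\<close>. The
    choice \<open>s = N / m * t\<close> makes this rise equal to \<open>t\<close>, with price impact
    \<open>t / (br * m)\<close>: the source of the extra term in \<open>C j\<close>.\<close>
  have p: "rt_price br ?\<beta>' dr = rt_price br \<beta> dr - t / (br * m)"
    unfolding rt_price_eq[OF br] sum_upd using br m by (simp add: add_divide_distrib diff_divide_distrib)
  have q: "rt_dispatch br ?\<beta>' dr j = rt_dispatch br \<beta> dr j + t"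
    unfolding rt_dispatch_def p using br m unfolding Nm by (simp add: field_simps)
  have g: "da_dispatch c dd j = da_price c dd / c j"
    by (simp add: da_dispatch_def field_simps)
  show ?thesis
    unfolding gen_profit_def p q g using br m c[of j]
    by (simp add: field_simps power2_eq_square)
qed

lemma rt_equilibrium_iff_foc:
  fixes c \<beta> :: "'g::finite \<Rightarrow> real"
  assumes c: "\<And>j. c j > 0" and br: "br > 0" and N: "CARD('g) > 1"
  shows "rt_equilibrium c br dd dr \<beta> \<longleftrightarrow>
    (\<forall>j. (1 / (br * (real CARD('g) - 1)) + c j) * rt_dispatch br \<beta> dr j
      = rt_price br \<beta> dr - da_price c dd)"
proof -
  define m where "m = real CARD('g) - 1"
  have m: "m > 0" using N by (simp add: m_def)
  have "(\<forall>x. gen_profit c br dd dr (\<beta>(j := x)) j \<le> gen_profit c br dd dr \<beta> j) \<longleftrightarrow>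
      (1 / (br * m) + c j) * rt_dispatch br \<beta> dr j = rt_price br \<beta> dr - da_price c dd" for j
  proof -
    let ?P = "\<lambda>x. gen_profit c br dd dr (\<beta>(j := x)) j \<le> gen_profit c br dd dr \<beta> j"
    let ?x = "\<lambda>t. \<beta> j - real CARD('g) / m * t"
    \<comment> \<open>For \<open>m > 0\<close> the map from dispatch changes to bids is onto, so
      testing all \<open>t\<close> tests all deviations.\<close>
    have "x = ?x ((\<beta> j - x) * m / real CARD('g))" for x
      using m by simp
    then have "(\<forall>x. ?P x) \<longleftrightarrow> (\<forall>t. ?P (?x t))" by metis
    also have "\<dots> \<longleftrightarrow> (\<forall>t.
        (rt_price br \<beta> dr - da_price c dd - (1 / (br * m) + c j) * rt_dispatch br \<beta> dr j) * t
        \<le> (1 / (br * m) + c j / 2) * t\<^sup>2)"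
      unfolding m_def gen_profit_deviation[of c, OF c br N] by simp
    also have "\<dots> \<longleftrightarrow>
        rt_price br \<beta> dr - da_price c dd - (1 / (br * m) + c j) * rt_dispatch br \<beta> dr j = 0"
      by (rule linear_le_quadratic_iff) (use br m c[of j] in \<open>simp add: add_pos_pos\<close>)
    finally show ?thesis by auto
  qed
  then show ?thesis unfolding rt_equilibrium_def m_def by simp
qed

text \<open>Each bid is chosen so that, at price \<open>p + dr / SC\<close>, generator
  \<open>j\<close> supplies the share \<open>inverse (C j) / SC\<close> of demand. The shares add up
  to one, so this is the clearing price.\<close>

lemma rt_outcome_of_affine_bids:
  fixes C :: "'g::finite \<Rightarrow> real" and p dr :: real
  assumes br: "br > 0" and SC: "SC = (\<Sum>k\<in>UNIV. inverse (C k))" and SCpos: "SC > 0"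
  defines "\<beta> \<equiv> \<lambda>j. br * (p + dr / SC) - inverse (C j) * (dr / SC)"
  shows "rt_price br \<beta> dr = p + dr / SC"
    and "rt_dispatch br \<beta> dr j = inverse (C j) * (dr / SC)"
proof -
  have "sum \<beta> UNIV = real CARD('g) * (br * (p + dr / SC)) - SC * (dr / SC)"
    unfolding \<beta>_def SC by (simp only: sum_subtractf sum_constant sum_distrib_right)
  then show price: "rt_price br \<beta> dr = p + dr / SC"
    using br SCpos by (simp add: rt_price_eq)
  show "rt_dispatch br \<beta> dr j = inverse (C j) * (dr / SC)"
    unfolding rt_dispatch_def price by (simp add: \<beta>_def)
qed

text \<open>The first-order conditions and power balance fix price and dispatch, and the bid is then
  read off the intercept function. Equality of whole bid profiles gives uniqueness in every subgame,
  also off the equilibrium path.\<close>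

lemma rt_equilibrium_iff:
  fixes c \<beta> C :: "'g::finite \<Rightarrow> real"
  assumes c: "\<And>j. c j > 0" and br: "br > 0" and N: "CARD('g) > 1"
    and C: "C = (\<lambda>j. 1 / (br * (real CARD('g) - 1)) + c j)"
    and SC: "SC = (\<Sum>k\<in>UNIV. inverse (C k))"
  shows "rt_equilibrium c br dd dr \<beta> \<longleftrightarrow>
    \<beta> = (\<lambda>j. br * (da_price c dd + dr / SC) - inverse (C j) * (dr / SC))" (is "_ \<longleftrightarrow> \<beta> = ?b")
proof -
  have Cpos: "C j > 0" for j using c[of j] br N by (simp add: C add_pos_pos)
  then have SCpos: "SC > 0" unfolding SC by (rule sum_inverse_pos)
  have foc: "rt_equilibrium c br dd dr \<beta> \<longleftrightarrow>
      (\<forall>j. rt_dispatch br \<beta> dr j = inverse (C j) * (rt_price br \<beta> dr - da_price c dd))"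
    unfolding rt_equilibrium_iff_foc[of c, OF c br N] C[THEN fun_cong, symmetric]
    using Cpos by (auto simp: field_simps less_imp_neq[THEN not_sym])
  show ?thesis
  proof
    assume "rt_equilibrium c br dd dr \<beta>"
    then have q: "rt_dispatch br \<beta> dr j = inverse (C j) * (rt_price br \<beta> dr - da_price c dd)" for j
      unfolding foc by blast
    have "dr = SC * (rt_price br \<beta> dr - da_price c dd)"
      using sum_rt_dispatch[OF br, of \<beta> dr] unfolding q SC by (simp add: sum_distrib_right)
    then have p: "rt_price br \<beta> dr = da_price c dd + dr / SC"
      using SCpos by (simp add: field_simps)
    show "\<beta> = ?b"
    proof
      fix j show "\<beta> j = ?b j" using q[of j] unfolding rt_dispatch_def p by simp
    qed
  next
    assume "\<beta> = ?b"
    then show "rt_equilibrium c br dd dr \<beta>"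
      unfolding foc using rt_outcome_of_affine_bids[OF br SC SCpos] by simp
  qed
qed

lemma rt_equilibrium_outcome:
  fixes c \<beta> C :: "'g::finite \<Rightarrow> real"
  assumes c: "\<And>j. c j > 0" and br: "br > 0" and N: "CARD('g) > 1"
    and C: "C = (\<lambda>j. 1 / (br * (real CARD('g) - 1)) + c j)"
    and SC: "SC = (\<Sum>k\<in>UNIV. inverse (C k))"
    and eq: "rt_equilibrium c br dd dr \<beta>"
  shows "rt_price br \<beta> dr = da_price c dd + dr / SC"
    and "rt_dispatch br \<beta> dr j = inverse (C j) * (dr / SC)"
proof -
  have "C j > 0" for j using c[of j] br N by (simp add: C add_pos_pos)
  then have "SC > 0" unfolding SC by (rule sum_inverse_pos)
  then show "rt_price br \<beta> dr = da_price c dd + dr / SC"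
    and "rt_dispatch br \<beta> dr j = inverse (C j) * (dr / SC)"
    using rt_outcome_of_affine_bids[OF br SC] eq rt_equilibrium_iff[of c, OF c br N C SC] by simp_all
qed

section \<open>The game among the loads\<close>

text \<open>\<open>pay\<close> is the payment once the followers' price response is substituted. It
  equals \<open>sum \<delta> UNIV / Sc * d l\<close> plus the price gap times the real-time demand
  of \<open>l\<close>, so it is strictly convex in the own decision.\<close>

lemma load_optimality_iff:
  fixes d \<delta> :: "'l::finite \<Rightarrow> real" and Sc SC :: real
  assumes Sc: "Sc > 0" and SC: "SC > 0"
  defines "pay \<equiv> \<lambda>\<delta> l. sum \<delta> UNIV / Sc * \<delta> l
    + (sum \<delta> UNIV / Sc + (\<Sum>i\<in>UNIV. d i - \<delta> i) / SC) * (d l - \<delta> l)"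
  shows "(\<forall>l x. pay \<delta> l \<le> pay (\<delta>(l := x)) l) \<longleftrightarrow>
    \<delta> = (\<lambda>l. d l + (1 / (real CARD('l) + 1) * sum d UNIV - d l) * (SC / Sc))"
    (is "_ \<longleftrightarrow> \<delta> = ?opt")
proof -
  let ?n = "real CARD('l)" and ?dr = "\<Sum>i\<in>UNIV. d i - \<delta> i"
  \<comment> \<open>Shifting demand \<open>t\<close> to the day-ahead stage lowers both aggregate
    and own real-time demand by \<open>t\<close>; their product yields the quadratic term
    \<open>t^2 / SC\<close>.\<close>
  have dev: "pay (\<delta>(l := \<delta> l + t)) l
      = pay \<delta> l + (d l / Sc - (?dr + (d l - \<delta> l)) / SC) * t + 1 / SC * t\<^sup>2" for l t
    unfolding pay_def sum_subtractf sum_upd using Sc SC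
    by (simp add: field_simps power2_eq_square)
  have "pay \<delta> l \<le> pay (\<delta>(l := \<delta> l + t)) l \<longleftrightarrow>
      ((?dr + (d l - \<delta> l)) / SC - d l / Sc) * t \<le> 1 / SC * t\<^sup>2" for l t
    using dev[of l t] unfolding left_diff_distrib by linarith
  then have "(\<forall>t. pay \<delta> l \<le> pay (\<delta>(l := \<delta> l + t)) l) \<longleftrightarrow>
      (?dr + (d l - \<delta> l)) / SC - d l / Sc = 0" for l
    using linear_le_quadratic_iff[of "1 / SC"] SC by simp
  moreover have "(?dr + (d l - \<delta> l)) / SC - d l / Sc = 0 \<longleftrightarrow>
      ?dr + (d l - \<delta> l) = d l * (SC / Sc)" for l
    using Sc SC by (simp add: field_simps)
  moreover have "(\<forall>x. pay \<delta> l \<le> pay (\<delta>(l := x)) l) \<longleftrightarrow>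
      (\<forall>t. pay \<delta> l \<le> pay (\<delta>(l := \<delta> l + t)) l)" for l
    by (metis add_diff_cancel_left' diff_add_cancel add.commute)
  ultimately have "(\<forall>l x. pay \<delta> l \<le> pay (\<delta>(l := x)) l) \<longleftrightarrow>
      (\<forall>l. ?dr + (d l - \<delta> l) = d l * (SC / Sc))"
    by simp
  also have "\<dots> \<longleftrightarrow> \<delta> = ?opt"
  proof
    assume foc: "\<forall>l. ?dr + (d l - \<delta> l) = d l * (SC / Sc)"
    then have "(\<Sum>l\<in>UNIV. ?dr + (d l - \<delta> l)) = (\<Sum>l\<in>UNIV. d l * (SC / Sc))" by simp
    \<comment> \<open>The conditions couple the loads only through \<open>?dr\<close>. It occurs
      once per load and once more as the sum of the own terms, whence the factor
      \<open>?n + 1\<close>.\<close>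
    then have "?n * ?dr + ?dr = sum d UNIV * (SC / Sc)"
      by (simp only: sum.distrib sum_distrib_right[symmetric]) simp
    then have "(?n + 1) * ?dr = sum d UNIV * (SC / Sc)"
      by (simp only: distrib_right mult_1)
    moreover have "?n + 1 \<noteq> 0" by linarith
    ultimately have "?dr = sum d UNIV * (SC / Sc) / (?n + 1)"
      by (metis nonzero_mult_div_cancel_left)
    then have dr: "?dr = 1 / (?n + 1) * sum d UNIV * (SC / Sc)"
      by simp
    show "\<delta> = ?opt"
    proof
      fix l show "\<delta> l = ?opt l" using foc[rule_format, of l] unfolding dr
        by (simp add: algebra_simps)
    qed
  next
    assume opt: "\<delta> = ?opt"
    \<comment> \<open>Conversely, \<open>?dr\<close> must be recomputed from the candidate: the
      fraction \<open>1 - ?n / (?n + 1) = 1 / (?n + 1)\<close> remains.\<close>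
    have "?dr = (\<Sum>l\<in>UNIV. (d l - 1 / (?n + 1) * sum d UNIV) * (SC / Sc))"
      by (rule sum.cong) (simp_all add: opt algebra_simps)
    also have "\<dots> = (sum d UNIV - ?n * (1 / (?n + 1) * sum d UNIV)) * (SC / Sc)"
      by (simp only: sum_distrib_right[symmetric] sum_subtractf sum_constant mult.assoc)
    also have "\<dots> = 1 / (?n + 1) * sum d UNIV * (SC / Sc)"
      by (simp add: field_simps)
    finally have dr: "?dr = 1 / (?n + 1) * sum d UNIV * (SC / Sc)" .
    show "\<forall>l. ?dr + (d l - \<delta> l) = d l * (SC / Sc)"
      unfolding dr by (simp add: opt algebra_simps)
  qed
  finally show ?thesis .
qed

section \<open>The two-stage equilibrium\<close>

lemma stackelberg_nash_iff:
  fixes c C :: "'g::finite \<Rightarrow> real" and d \<delta> :: "'l::finite \<Rightarrow> real"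
  assumes c: "\<And>j. c j > 0" and br: "br > 0" and N: "CARD('g) > 1"
    and C: "C = (\<lambda>j. 1 / (br * (real CARD('g) - 1)) + c j)"
    and Sc: "Sc = (\<Sum>k\<in>UNIV. inverse (c k))"
    and SC: "SC = (\<Sum>k\<in>UNIV. inverse (C k))"
  shows "stackelberg_nash c d br \<delta> \<sigma> \<longleftrightarrow>
    \<delta> = (\<lambda>l. d l + (1 / (real CARD('l) + 1) * sum d UNIV - d l) * (SC / Sc)) \<and>
    \<sigma> = (\<lambda>\<delta>' j. br * (da_price c (sum \<delta>' UNIV) + (\<Sum>i\<in>UNIV. d i - \<delta>' i) / SC)
          - inverse (C j) * ((\<Sum>i\<in>UNIV. d i - \<delta>' i) / SC))"
    (is "_ \<longleftrightarrow> ?opt \<and> \<sigma> = ?\<sigma>")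
proof -
  let ?follow = "\<forall>\<delta>'. rt_equilibrium c br (sum \<delta>' UNIV) (\<Sum>i\<in>UNIV. d i - \<delta>' i) (\<sigma> \<delta>')"
  let ?lead = "\<forall>l x. load_payment c d br \<sigma> \<delta> l \<le> load_payment c d br \<sigma> (\<delta>(l := x)) l"
  have Scpos: "Sc > 0" unfolding Sc using c by (rule sum_inverse_pos)
  have "C j > 0" for j using c[of j] br N by (simp add: C add_pos_pos)
  then have SCpos: "SC > 0" unfolding SC by (rule sum_inverse_pos)
  have follow: "?follow \<longleftrightarrow> \<sigma> = ?\<sigma>"
    unfolding rt_equilibrium_iff[of c, OF c br N C SC] by (simp add: fun_eq_iff)
  \<comment> \<open>A deviating load's payment depends on \<open>\<sigma>\<close> at the deviated
    profile. It becomes explicit because \<open>?follow\<close> prescribes equilibrium play after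
    every profile.\<close>
  have lead: "?lead \<longleftrightarrow> ?opt" if ?follow
  proof -
    have "load_payment c d br \<sigma> \<delta>' l = sum \<delta>' UNIV / Sc * \<delta>' l
        + (sum \<delta>' UNIV / Sc + (\<Sum>i\<in>UNIV. d i - \<delta>' i) / SC) * (d l - \<delta>' l)" for \<delta>' l
      unfolding load_payment_def
      using rt_equilibrium_outcome(1)[of c, OF c br N C SC that[rule_format, of \<delta>']]
      by (simp add: da_price_eq[of c, OF c] Sc)
    then show ?thesis using load_optimality_iff[OF Scpos SCpos, of \<delta> d] by simp
  qed
  have "stackelberg_nash c d br \<delta> \<sigma> \<longleftrightarrow> ?follow \<and> ?lead"
    unfolding stackelberg_nash_def ..
  with follow lead show ?thesis by blast
qed

theorem theorem7:
  fixes c :: "'g::finite \<Rightarrow> real" and d :: "'l::finite \<Rightarrow> real" and bd br :: real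
    and C :: "'g \<Rightarrow> real" and D Sc SC n :: real
  assumes "\<And>j. c j > 0" and "\<And>l. d l > 0" and "bd > 0" and "br > 0"
    and "CARD('g) > 1"
    and "C = (\<lambda>j. 1 / (br * (real CARD('g) - 1)) + c j)"
    and "D = (\<Sum>l\<in>UNIV. d l)"
    and "Sc = (\<Sum>k\<in>UNIV. inverse (c k))"
    and "SC = (\<Sum>k\<in>UNIV. inverse (C k))"
    and "n = real CARD('l)"
  shows "(\<exists>!E :: ('l \<Rightarrow> real) \<times> (('l \<Rightarrow> real) \<Rightarrow> 'g \<Rightarrow> real).
            stackelberg_nash c d br (fst E) (snd E)) \<and>
         (\<forall>\<delta> \<sigma>. stackelberg_nash c d br \<delta> \<sigma> \<longrightarrow>
           (let dd = (\<Sum>l\<in>UNIV. \<delta> l); dr = (\<Sum>l\<in>UNIV. d l - \<delta> l);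
                lamd = da_price c dd; lamr = rt_price br (\<sigma> \<delta>) dr in
             (\<forall>j. da_dispatch c dd j =
                (1 - SC / ((n + 1) * Sc)) * (inverse (c j) / Sc) * D) \<and>
             (\<forall>j. rt_dispatch br (\<sigma> \<delta>) dr j = inverse (C j) / (n + 1) * (D / Sc)) \<and>
             (\<forall>j. da_intercept bd c dd j =
                (bd - bd * SC / ((n + 1) * Sc)
                  - inverse (c j) * (1 - SC / ((n + 1) * Sc))) * (D / Sc)) \<and>
             (\<forall>l. \<delta> l = d l + (1 / (n + 1) * D - d l) * (SC / Sc)) \<and>
             (\<forall>l. d l - \<delta> l = (d l - 1 / (n + 1) * D) * (SC / Sc)) \<and>
             lamd = D / Sc - 1 / (n + 1) * (SC / Sc) * (D / Sc) \<and>
             lamr = lamd + 1 / (n + 1) * (D / Sc)))"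
proof -
  note pos = assms(1) and br = assms(4) and N = assms(5) and C = assms(6) and D = assms(7)
    and Sc = assms(8) and SC = assms(9) and n = assms(10)
  note iff = stackelberg_nash_iff[of c, OF pos br N C Sc SC]
  have Scpos: "Sc > 0" unfolding Sc using pos by (rule sum_inverse_pos)
  have "C j > 0" for j using pos[of j] br N by (simp add: C add_pos_pos)
  then have SCpos: "SC > 0" unfolding SC by (rule sum_inverse_pos)
  have npos: "n > 0" unfolding n by simp
  show ?thesis
  proof (intro conjI allI impI)
    show "\<exists>!E :: ('l \<Rightarrow> real) \<times> (('l \<Rightarrow> real) \<Rightarrow> 'g \<Rightarrow> real).
        stackelberg_nash c d br (fst E) (snd E)"
      \<comment> \<open>After unfolding, both components of the pair are given by equations, so
        unification supplies the witness.\<close>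
      unfolding iff by (rule ex1I[of _ "(_, _)"]) (auto simp: prod_eq_iff)
  next
    fix \<delta> :: "'l \<Rightarrow> real" and \<sigma> :: "('l \<Rightarrow> real) \<Rightarrow> 'g \<Rightarrow> real"
    assume sn: "stackelberg_nash c d br \<delta> \<sigma>"
    let ?dd = "\<Sum>l\<in>UNIV. \<delta> l" and ?dr = "\<Sum>l\<in>UNIV. d l - \<delta> l"
    have \<delta>: "\<delta> l = d l + (1 / (n + 1) * D - d l) * (SC / Sc)" for l
      using sn unfolding iff n D by simp
    have \<delta>r: "d l - \<delta> l = (d l - 1 / (n + 1) * D) * (SC / Sc)" for l
      unfolding \<delta> by (simp add: algebra_simps)
    have "?dr = (D - n * (1 / (n + 1) * D)) * (SC / Sc)"
      unfolding \<delta>r D n by (simp only: sum_distrib_right[symmetric] sum_subtractf sum_constant mult.assoc)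
    also have "\<dots> = 1 / (n + 1) * D * (SC / Sc)"
      using npos by (simp add: field_simps)
    finally have dr: "?dr = 1 / (n + 1) * D * (SC / Sc)" .
    then have dd: "?dd = D - 1 / (n + 1) * D * (SC / Sc)"
      by (simp add: sum_subtractf D)
    have eq: "rt_equilibrium c br ?dd ?dr (\<sigma> \<delta>)"
      using sn unfolding stackelberg_nash_def by blast
    have lamd: "da_price c ?dd = D / Sc - 1 / (n + 1) * (SC / Sc) * (D / Sc)"
      unfolding da_price_eq[of c, OF pos] Sc[symmetric] dd by (simp add: diff_divide_distrib)
    \<comment> \<open>This is the price gap; \<open>SC\<close> cancels because the loads choose
      \<open>?dr\<close> proportional to it.\<close>
    have drSC: "?dr / SC = 1 / (n + 1) * (D / Sc)"
      unfolding dr using SCpos by simp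
    have lamr: "rt_price br (\<sigma> \<delta>) ?dr = da_price c ?dd + 1 / (n + 1) * (D / Sc)"
      using rt_equilibrium_outcome(1)[of c, OF pos br N C SC eq] unfolding drSC .
    have q: "rt_dispatch br (\<sigma> \<delta>) ?dr j = inverse (C j) / (n + 1) * (D / Sc)" for j
      using rt_equilibrium_outcome(2)[of c, OF pos br N C SC eq] unfolding drSC by simp
    have lamd': "da_price c ?dd = (1 - SC / ((n + 1) * Sc)) * (D / Sc)"
      unfolding lamd by (simp add: left_diff_distrib diff_divide_distrib)
    have g: "da_dispatch c ?dd j = (1 - SC / ((n + 1) * Sc)) * (inverse (c j) / Sc) * D" for j
      unfolding da_dispatch_def lamd' by simp
    \<comment> \<open>The subtracted term is the day-ahead dispatch per \<open>D / Sc\<close>, hence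
      \<open>inverse (c j)\<close>. The term \<open>inverse (C j) / (n + 1)\<close> in the informal
      formula is the real-time dispatch in this unit; it is strictly smaller, since
      \<open>C j > c j\<close> and \<open>SC < Sc\<close>, and so does not fit the day-ahead
      intercept relation.\<close>
    have b: "da_intercept bd c ?dd j = (bd - bd * SC / ((n + 1) * Sc)
        - inverse (c j) * (1 - SC / ((n + 1) * Sc))) * (D / Sc)" for j
      unfolding da_intercept_def da_dispatch_def lamd' by (simp add: algebra_simps)
    show "let dd = ?dd; dr = ?dr; lamd = da_price c dd; lamr = rt_price br (\<sigma> \<delta>) dr in
             (\<forall>j. da_dispatch c dd j =
                (1 - SC / ((n + 1) * Sc)) * (inverse (c j) / Sc) * D) \<and>
             (\<forall>j. rt_dispatch br (\<sigma> \<delta>) dr j = inverse (C j) / (n + 1) * (D / Sc)) \<and>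
             (\<forall>j. da_intercept bd c dd j =
                (bd - bd * SC / ((n + 1) * Sc)
                  - inverse (c j) * (1 - SC / ((n + 1) * Sc))) * (D / Sc)) \<and>
             (\<forall>l. \<delta> l = d l + (1 / (n + 1) * D - d l) * (SC / Sc)) \<and>
             (\<forall>l. d l - \<delta> l = (d l - 1 / (n + 1) * D) * (SC / Sc)) \<and>
             lamd = D / Sc - 1 / (n + 1) * (SC / Sc) * (D / Sc) \<and>
             lamr = lamd + 1 / (n + 1) * (D / Sc)"
      unfolding Let_def using g q b \<delta> \<delta>r lamd lamr by blast
  qed
qed

end
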